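(* Let $(M^n,g)$ be a Riemannian manifold and let $E$ be an involutive distribution of rank $r$ on $M$. Let $\nabla$ be the Levi-Civita connection of $(M,g)$ with respect to $E$. Then for any $X,Y\in\Gamma(E)$ and $\xi\in\Gamma(E^\perp)$, $$g(\nabla_XY,\xi)=0,$$ and equivalently $g(Y,\nabla_X\xi)=0$. In other words, $E$ is totally geodesic with respect to the affine connection $\nabla$.
   Context: A distribution of rank $r$ on a smooth manifold $M^n$ is a smooth vector subbundle $E$ of $TM$ of rank $r$; it is involutive if $[X,Y]\in\Gamma(E)$ for all $X,Y\in\Gamma(E)$. $\Gamma(\cdot)$ denotes smooth sections, $E^\perp$ is the orthogonal complement of $E$ in $TM$ with respect to $g$, and $L$ is the Lie derivative. The torsion of an affine connection $\nabla$ is $\tau(X,Y)=\nabla_XY-\nabla_YX-[X,Y]$. The Levi-Civita connection of $(M,g)$ with respect to $E$ is the unique affine connection $\nabla$ on $M$ compatible with $g$ (i.e. $\nabla g=0$) whose torsion satisfies, for all $X,Y\in\Gamma(E)$ and $\xi,\eta\in\Gamma(E^\perp)$: (1) $\tau(X,Y)=\tau(\xi,\eta)=0$; (2) $g(\tau(\xi,X),Y)=\frac12(L_\xi g)(X,Y)$; (3) $g(\tau(\xi,X),\eta)=-\frac12(L_Xg)(\xi,\eta)$. This connection is in general different from the usual (torsion-free) Levi-Civita connection of $g$. That $E$ is totally geodesic with respect to $\nabla$ means that $\nabla_XY\in\Gamma(E)$ for all $X,Y\in\Gamma(E)$. *)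

theory Defs
  imports "HOL-Analysis.Analysis" "HOL-Library.Function_Algebras"
begin

text \<open>Pointwise scalar multiplication, so that functions, tangent vectors (which are functionals on
  functions) and vector fields live in real vector spaces and the library notions
  \<^const>\<open>subspace\<close>, \<^const>\<open>span\<close> and \<^const>\<open>dim\<close> apply to them.\<close>

instantiation "fun" :: (type, real_vector) real_vector
begin

definition scaleR_fun :: "real \<Rightarrow> ('a \<Rightarrow> 'b) \<Rightarrow> 'a \<Rightarrow> 'b"
  where "scaleR_fun c f = (\<lambda>x. c *\<^sub>R f x)"

instance
  by standard (simp_all add: scaleR_fun_def fun_eq_iff plus_fun_def scaleR_add_right scaleR_add_left)

end


section \<open>Smooth manifolds\<close>

text \<open>The predicates below are meant for open sets \<open>S\<close> of a finite-dimensional space, where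
  \<open>Ck_on k\<close> is the usual class \<open>C\<^sup>k\<close>: all directional derivatives, iterated up to \<open>k\<close> times,
  exist and are continuous.\<close>

primrec Ck_on :: "nat \<Rightarrow> 'b::real_normed_vector set \<Rightarrow> ('b \<Rightarrow> 'c::real_normed_vector) \<Rightarrow> bool" where
  "Ck_on 0 S f \<longleftrightarrow> continuous_on S f"
| "Ck_on (Suc k) S f \<longleftrightarrow>
     (\<forall>x\<in>S. f differentiable (at x)) \<and>
     (\<forall>v. Ck_on k S (\<lambda>x. frechet_derivative f (at x) v))"

definition smooth_on :: "'b::real_normed_vector set \<Rightarrow> ('b \<Rightarrow> 'c::real_normed_vector) \<Rightarrow> bool"
  where "smooth_on S f \<longleftrightarrow> (\<forall>k. Ck_on k S f)"

text \<open>A chart is a pair of an open domain and a coordinate map.\<close>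

type_synonym ('a, 'n) chart = "'a set \<times> ('a \<Rightarrow> real ^ 'n)"

definition is_chart :: "('a::topological_space, 'n::finite) chart \<Rightarrow> bool"
  where "is_chart = (\<lambda>(U, \<phi>).
    open U \<and> open (\<phi> ` U) \<and> homeomorphism U (\<phi> ` U) \<phi> (inv_into U \<phi>))"

text \<open>The manifold \<open>M\<close> is the whole type \<open>'a\<close>, and its dimension is \<open>CARD('n)\<close>.  The atlas is not
  required to be maximal.\<close>

definition smooth_manifold ::
    "('a::{t2_space, second_countable_topology}, 'n::finite) chart set \<Rightarrow> bool"
  where "smooth_manifold A \<longleftrightarrow>
    (\<forall>c\<in>A. is_chart c) \<and>
    (\<Union>(U, \<phi>)\<in>A. U) = UNIV \<and>
    (\<forall>(U, \<phi>)\<in>A. \<forall>(V, \<psi>)\<in>A. smooth_on (\<phi> ` (U \<inter> V)) (\<psi> \<circ> inv_into U \<phi>))"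

definition smooth_fun_on ::
    "('a::topological_space, 'n::finite) chart set \<Rightarrow> 'a set \<Rightarrow> ('a \<Rightarrow> real) \<Rightarrow> bool"
  where "smooth_fun_on A U f \<longleftrightarrow>
    (\<forall>(V, \<phi>)\<in>A. smooth_on (\<phi> ` (U \<inter> V)) (f \<circ> inv_into V \<phi>))"

definition smooth_functions :: "('a::topological_space, 'n::finite) chart set \<Rightarrow> ('a \<Rightarrow> real) set"
  where "smooth_functions A = {f. smooth_fun_on A UNIV f}"


section \<open>Tangent vectors and vector fields\<close>

type_synonym 'a tvec = "('a \<Rightarrow> real) \<Rightarrow> real"
type_synonym 'a vfield = "'a \<Rightarrow> 'a tvec"

text \<open>Tangent vectors at \<open>p\<close> are the derivations at \<open>p\<close> of the algebra of smooth functions.  Their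
  value on non-smooth functions is fixed to be \<open>0\<close>, so that each derivation is represented by
  exactly one HOL function.\<close>

definition tangent_space :: "('a::topological_space, 'n::finite) chart set \<Rightarrow> 'a \<Rightarrow> 'a tvec set"
  where "tangent_space A p = {v.
    (\<forall>f. f \<notin> smooth_functions A \<longrightarrow> v f = 0) \<and>
    (\<forall>f\<in>smooth_functions A. \<forall>h\<in>smooth_functions A. v (f + h) = v f + v h) \<and>
    (\<forall>c. \<forall>f\<in>smooth_functions A. v (c *\<^sub>R f) = c * v f) \<and>
    (\<forall>f\<in>smooth_functions A. \<forall>h\<in>smooth_functions A. v (f * h) = f p * v h + h p * v f)}"

text \<open>Smooth sections of the tangent bundle over an open set \<open>U\<close>; values outside \<open>U\<close> are
  irrelevant.  Testing on globally defined smooth functions suffices, since near each point the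
  coordinate functions extend to global smooth functions.\<close>

definition smooth_vfield_on ::
    "('a::topological_space, 'n::finite) chart set \<Rightarrow> 'a set \<Rightarrow> 'a vfield \<Rightarrow> bool"
  where "smooth_vfield_on A U X \<longleftrightarrow>
    (\<forall>p\<in>U. X p \<in> tangent_space A p) \<and>
    (\<forall>f\<in>smooth_functions A. smooth_fun_on A U (\<lambda>p. X p f))"

definition vector_fields :: "('a::topological_space, 'n::finite) chart set \<Rightarrow> 'a vfield set"
  where "vector_fields A = {X. smooth_vfield_on A UNIV X}"

definition vf_scale :: "('a \<Rightarrow> real) \<Rightarrow> 'a vfield \<Rightarrow> 'a vfield"
  where "vf_scale f X = (\<lambda>p. f p *\<^sub>R X p)"

definition vf_apply :: "'a vfield \<Rightarrow> ('a \<Rightarrow> real) \<Rightarrow> 'a \<Rightarrow> real"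
  where "vf_apply X f = (\<lambda>p. X p f)"

definition lie_bracket :: "'a vfield \<Rightarrow> 'a vfield \<Rightarrow> 'a vfield"
  where "lie_bracket X Y = (\<lambda>p f. X p (vf_apply Y f) - Y p (vf_apply X f))"


section \<open>Riemannian metrics\<close>

type_synonym 'a metric = "'a \<Rightarrow> 'a tvec \<Rightarrow> 'a tvec \<Rightarrow> real"

definition metric_apply :: "'a metric \<Rightarrow> 'a vfield \<Rightarrow> 'a vfield \<Rightarrow> 'a \<Rightarrow> real"
  where "metric_apply g X Y = (\<lambda>p. g p (X p) (Y p))"

definition inner_product_on :: "'v::real_vector set \<Rightarrow> ('v \<Rightarrow> 'v \<Rightarrow> real) \<Rightarrow> bool"
  where "inner_product_on V b \<longleftrightarrow>
    (\<forall>v\<in>V. \<forall>w\<in>V. b v w = b w v) \<and>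
    (\<forall>u\<in>V. \<forall>v\<in>V. \<forall>w\<in>V. b (u + v) w = b u w + b v w) \<and>
    (\<forall>c. \<forall>v\<in>V. \<forall>w\<in>V. b (c *\<^sub>R v) w = c * b v w) \<and>
    (\<forall>v\<in>V. v \<noteq> 0 \<longrightarrow> b v v > 0)"

definition riemannian_metric ::
    "('a::topological_space, 'n::finite) chart set \<Rightarrow> 'a metric \<Rightarrow> bool"
  where "riemannian_metric A g \<longleftrightarrow>
    (\<forall>p. inner_product_on (tangent_space A p) (g p)) \<and>
    (\<forall>U X Y. open U \<longrightarrow> smooth_vfield_on A U X \<longrightarrow> smooth_vfield_on A U Y \<longrightarrow>
       smooth_fun_on A U (metric_apply g X Y))"

definition riemannian_manifold ::
    "('a::{t2_space, second_countable_topology}, 'n::finite) chart set \<Rightarrow> 'a metric \<Rightarrow> bool"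
  where "riemannian_manifold A g \<longleftrightarrow> smooth_manifold A \<and> riemannian_metric A g"

text \<open>The Lie derivative of a covariant 2-tensor field, evaluated on vector fields by the Leibniz rule
  \<open>Z (g (X, Y)) = (L\<^sub>Z g) (X, Y) + g ([Z, X], Y) + g (X, [Z, Y])\<close>.\<close>

definition lie_derivative :: "'a vfield \<Rightarrow> 'a metric \<Rightarrow> 'a vfield \<Rightarrow> 'a vfield \<Rightarrow> 'a \<Rightarrow> real"
  where "lie_derivative Z g X Y =
    vf_apply Z (metric_apply g X Y)
    - metric_apply g (lie_bracket Z X) Y - metric_apply g X (lie_bracket Z Y)"


section \<open>Distributions\<close>

text \<open>Smooth subbundles of rank \<open>r\<close> of the tangent bundle.  As \<^term>\<open>dim (E q) = r\<close>, the \<open>r\<close>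
  spanning local sections are automatically linearly independent at each point.\<close>

definition distribution ::
    "('a::topological_space, 'n::finite) chart set \<Rightarrow> nat \<Rightarrow> ('a \<Rightarrow> 'a tvec set) \<Rightarrow> bool"
  where "distribution A r E \<longleftrightarrow>
    (\<forall>p. subspace (E p) \<and> E p \<subseteq> tangent_space A p \<and> dim (E p) = r) \<and>
    (\<forall>p. \<exists>U e. open U \<and> p \<in> U \<and>
       (\<forall>i<r. smooth_vfield_on A U (e i)) \<and>
       (\<forall>q\<in>U. E q = span ((\<lambda>i. e i q) ` {..<r})))"

definition sections ::
    "('a::topological_space, 'n::finite) chart set \<Rightarrow> ('a \<Rightarrow> 'a tvec set) \<Rightarrow> 'a vfield set"
  where "sections A E = {X \<in> vector_fields A. \<forall>p. X p \<in> E p}"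

definition involutive ::
    "('a::topological_space, 'n::finite) chart set \<Rightarrow> ('a \<Rightarrow> 'a tvec set) \<Rightarrow> bool"
  where "involutive A E \<longleftrightarrow>
    (\<forall>X\<in>sections A E. \<forall>Y\<in>sections A E. lie_bracket X Y \<in> sections A E)"

definition orth ::
    "('a::topological_space, 'n::finite) chart set \<Rightarrow> 'a metric \<Rightarrow> ('a \<Rightarrow> 'a tvec set) \<Rightarrow>
     'a \<Rightarrow> 'a tvec set"
  where "orth A g E p = {v \<in> tangent_space A p. \<forall>w\<in>E p. g p v w = 0}"


section \<open>Connections\<close>

text \<open>Only the values \<open>D X Y\<close> (written \<open>\<nabla>\<^sub>X Y\<close> on paper) on smooth vector fields matter.\<close>

type_synonym 'a connection = "'a vfield \<Rightarrow> 'a vfield \<Rightarrow> 'a vfield"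

definition affine_connection ::
    "('a::topological_space, 'n::finite) chart set \<Rightarrow> 'a connection \<Rightarrow> bool"
  where "affine_connection A D \<longleftrightarrow>
    (\<forall>X\<in>vector_fields A. \<forall>Y\<in>vector_fields A. D X Y \<in> vector_fields A) \<and>
    (\<forall>X\<in>vector_fields A. \<forall>X'\<in>vector_fields A. \<forall>Y\<in>vector_fields A.
       D (X + X') Y = D X Y + D X' Y) \<and>
    (\<forall>f\<in>smooth_functions A. \<forall>X\<in>vector_fields A. \<forall>Y\<in>vector_fields A.
       D (vf_scale f X) Y = vf_scale f (D X Y)) \<and>
    (\<forall>X\<in>vector_fields A. \<forall>Y\<in>vector_fields A. \<forall>Y'\<in>vector_fields A.
       D X (Y + Y') = D X Y + D X Y') \<and>
    (\<forall>f\<in>smooth_functions A. \<forall>X\<in>vector_fields A. \<forall>Y\<in>vector_fields A.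
       D X (vf_scale f Y) = vf_scale (vf_apply X f) Y + vf_scale f (D X Y))"

definition metric_compatible ::
    "('a::topological_space, 'n::finite) chart set \<Rightarrow> 'a metric \<Rightarrow> 'a connection \<Rightarrow> bool"
  where "metric_compatible A g D \<longleftrightarrow>
    (\<forall>X\<in>vector_fields A. \<forall>Y\<in>vector_fields A. \<forall>Z\<in>vector_fields A.
       vf_apply X (metric_apply g Y Z) = metric_apply g (D X Y) Z + metric_apply g Y (D X Z))"

definition torsion :: "'a connection \<Rightarrow> 'a vfield \<Rightarrow> 'a vfield \<Rightarrow> 'a vfield"
  where "torsion D X Y = D X Y - D Y X - lie_bracket X Y"

text \<open>\<open>D\<close> is the Levi-Civita connection of the metric with respect to \<open>E\<close>; these conditions
  determine \<open>D\<close> uniquely on smooth vector fields.\<close>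

definition levi_civita_wrt ::
    "('a::topological_space, 'n::finite) chart set \<Rightarrow> 'a metric \<Rightarrow> ('a \<Rightarrow> 'a tvec set) \<Rightarrow>
     'a connection \<Rightarrow> bool"
  where "levi_civita_wrt A g E D \<longleftrightarrow>
    affine_connection A D \<and> metric_compatible A g D \<and>
    (\<forall>X\<in>sections A E. \<forall>Y\<in>sections A E. torsion D X Y = 0) \<and>
    (\<forall>\<xi>\<in>sections A (orth A g E). \<forall>\<eta>\<in>sections A (orth A g E). torsion D \<xi> \<eta> = 0) \<and>
    (\<forall>\<xi>\<in>sections A (orth A g E). \<forall>X\<in>sections A E. \<forall>Y\<in>sections A E.
       metric_apply g (torsion D \<xi> X) Y = (1/2) *\<^sub>R lie_derivative \<xi> g X Y) \<and>
    (\<forall>\<xi>\<in>sections A (orth A g E). \<forall>\<eta>\<in>sections A (orth A g E). \<forall>X\<in>sections A E.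
       metric_apply g (torsion D \<xi> X) \<eta> = - ((1/2) *\<^sub>R lie_derivative X g \<xi> \<eta>))"

definition totally_geodesic ::
    "('a::topological_space, 'n::finite) chart set \<Rightarrow> 'a connection \<Rightarrow> ('a \<Rightarrow> 'a tvec set) \<Rightarrow> bool"
  where "totally_geodesic A D E \<longleftrightarrow>
    (\<forall>X\<in>sections A E. \<forall>Y\<in>sections A E. D X Y \<in> sections A E)"

end

theory Submission
  imports Defs
begin

text \<open>The second fundamental form \<open>h(X, Y) = g(\<nabla>\<^sub>X Y, \<xi>)\<close> of \<open>E\<close> is at once symmetric and
  skew-symmetric. It is symmetric because \<open>\<nabla>\<^sub>X Y - \<nabla>\<^sub>Y X = [X, Y]\<close> on sections of \<open>E\<close>, and \<open>E\<close> is
  involutive. For skew-symmetry, expand the prescribed value of \<open>g(\<tau>(\<xi>, X), Y)\<close> and add the same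
  identity with \<open>X\<close> and \<open>Y\<close> exchanged: metric compatibility turns
  \<open>g(\<nabla>\<^sub>\<xi> X, Y) + g(X, \<nabla>\<^sub>\<xi> Y)\<close> into \<open>\<xi> g(X, Y)\<close>, all terms of the Lie derivative cancel, and
  \<open>g(\<nabla>\<^sub>X \<xi>, Y) + g(\<nabla>\<^sub>Y \<xi>, X) = 0\<close> is left. Since \<open>g(Y, \<xi>) = 0\<close>, metric compatibility also
  gives \<open>g(Y, \<nabla>\<^sub>X \<xi>) = - h(X, Y)\<close>, so \<open>h\<close> is skew-symmetric and therefore zero. This is lemma
  \<open>second_fundamental_form_eq_0\<close>.

  The expansion uses that \<open>g\<close> is bilinear on tangent vectors, so brackets of vector fields must be
  seen to consist of derivations (\<open>lie_bracket_in_tangent_space\<close>). For this,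
  smooth functions must be closed under products, on which the Leibniz rule is evaluated.

  That \<open>h = 0\<close> forces \<open>\<nabla>\<^sub>X Y\<close> into \<open>E\<close> requires enough global sections of the orthogonal
  complement. One suffices, namely the component \<open>W\<close> of \<open>Z = \<nabla>\<^sub>X Y\<close> orthogonal to \<open>E\<close>:
  \<open>g(W, W) = g(Z, W) = 0\<close> gives \<open>W = 0\<close>. This choice avoids extending local sections by bump
  functions, because \<open>W\<close> is global from the start and its smoothness is a local question, answered
  by Gram-Schmidt elimination in a local frame of \<open>E\<close>
  (\<open>local_orthogonal_component\<close>, \<open>orthogonal_component\<close>).\<close>


section \<open>Calculus of smooth functions on open sets\<close>

lemma Ck_on_subset: "Ck_on k T f \<Longrightarrow> S \<subseteq> T \<Longrightarrow> Ck_on k S f"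
  by (induction k arbitrary: f) (auto intro: continuous_on_subset)

lemma Ck_on_SucD: "Ck_on (Suc k) S f \<Longrightarrow> Ck_on k S f"
proof (induction k arbitrary: f)
  case 0
  then show ?case
    by (auto intro!: continuous_at_imp_continuous_on differentiable_imp_continuous_within)
next
  case (Suc k)
  show ?case
    unfolding Ck_on.simps(2)[of k]
  proof (intro conjI allI)
    show "\<forall>x\<in>S. f differentiable (at x)"
      using Suc.prems by simp
    show "Ck_on k S (\<lambda>x. frechet_derivative f (at x) v)" for v
      using Suc.prems by (intro Suc.IH) (simp only: Ck_on.simps(2)[of "Suc k"])
  qed
qed

lemma Ck_on_local:
  assumes "\<And>x. x \<in> S \<Longrightarrow> \<exists>T. open T \<and> x \<in> T \<and> Ck_on k T f"
  shows "Ck_on k S f"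
  using assms
proof (induction k arbitrary: f)
  case 0
  have "isCont f x" if "x \<in> S" for x
    using 0[OF that] by (auto simp: continuous_on_eq_continuous_at)
  then show ?case by (simp add: continuous_at_imp_continuous_on)
next
  case (Suc k)
  show ?case
    unfolding Ck_on.simps
  proof (intro conjI allI ballI)
    show "f differentiable (at x)" if "x \<in> S" for x
      using Suc.prems[OF that] by auto
    show "Ck_on k S (\<lambda>x. frechet_derivative f (at x) v)" for v
      by (rule Suc.IH) (use Suc.prems in fastforce)
  qed
qed

lemma Ck_on_cong:
  assumes "open S" "\<And>x. x \<in> S \<Longrightarrow> f x = h x" "Ck_on k S f"
  shows "Ck_on k S h"
  using assms(2,3)
proof (induction k arbitrary: f h)
  case 0
  then show ?case by (metis Ck_on.simps(1) continuous_on_eq)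
next
  case (Suc k)
  have der: "(h has_derivative frechet_derivative f (at x)) (at x)" if "x \<in> S" for x
  proof (rule has_derivative_transform_within_open[OF _ assms(1) that])
    show "(f has_derivative frechet_derivative f (at x)) (at x)"
      using Suc.prems(2) that by (simp add: frechet_derivative_works)
  qed (use Suc.prems(1) in auto)
  show ?case
    unfolding Ck_on.simps
  proof (intro conjI allI ballI)
    show "h differentiable (at x)" if "x \<in> S" for x
      using der[OF that] by (auto simp: differentiable_def)
    show "Ck_on k S (\<lambda>x. frechet_derivative h (at x) v)" for v
      by (rule Suc.IH[of "\<lambda>x. frechet_derivative f (at x) v"])
        (use Suc.prems(2) frechet_derivative_at[OF der] in auto)
  qed
qed

text \<open>The induction step for sums, products and reciprocals: exhibiting a derivative of class
  \<open>C\<^sup>k\<close> is enough.\<close>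

lemma Ck_on_SucI:
  assumes "open S" "\<And>x. x \<in> S \<Longrightarrow> (f has_derivative f' x) (at x)" "\<And>v. Ck_on k S (\<lambda>x. f' x v)"
  shows "Ck_on (Suc k) S f"
  unfolding Ck_on.simps
proof (intro conjI allI ballI)
  show "f differentiable (at x)" if "x \<in> S" for x
    using assms(2)[OF that] by (auto simp: differentiable_def)
  show "Ck_on k S (\<lambda>x. frechet_derivative f (at x) v)" for v
    by (rule Ck_on_cong[OF assms(1) _ assms(3)[of v]])
      (use frechet_derivative_at[OF assms(2)] in auto)
qed

lemma Ck_on_has_derivative:
  "Ck_on (Suc k) S f \<Longrightarrow> x \<in> S \<Longrightarrow> (f has_derivative frechet_derivative f (at x)) (at x)"
  by (simp add: frechet_derivative_works)

lemma Ck_on_add: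
  assumes "open S" "Ck_on k S f" "Ck_on k S h"
  shows "Ck_on k S (\<lambda>x. f x + h x)"
  using assms(2,3)
proof (induction k arbitrary: f h)
  case 0
  then show ?case by (auto intro: continuous_on_add)
next
  case (Suc k)
  show ?case
  proof (rule Ck_on_SucI[OF assms(1)])
    show "((\<lambda>x. f x + h x) has_derivative
        (\<lambda>v. frechet_derivative f (at x) v + frechet_derivative h (at x) v)) (at x)"
      if "x \<in> S" for x
      using Suc.prems[THEN Ck_on_has_derivative, OF that] by (rule has_derivative_add)
    show "Ck_on k S (\<lambda>x. frechet_derivative f (at x) v + frechet_derivative h (at x) v)" for v
      using Suc.prems by (intro Suc.IH) auto
  qed
qed

lemma Ck_on_mult:
  fixes f h :: "'b::real_normed_vector \<Rightarrow> 'c::real_normed_algebra"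
  assumes "open S" "Ck_on k S f" "Ck_on k S h"
  shows "Ck_on k S (\<lambda>x. f x * h x)"
  using assms(2,3)
proof (induction k arbitrary: f h)
  case 0
  then show ?case by (auto intro: continuous_on_mult)
next
  case (Suc k)
  show ?case
  proof (rule Ck_on_SucI[OF assms(1)])
    show "((\<lambda>x. f x * h x) has_derivative
        (\<lambda>v. f x * frechet_derivative h (at x) v + frechet_derivative f (at x) v * h x)) (at x)"
      if "x \<in> S" for x
      using Suc.prems[THEN Ck_on_has_derivative, OF that] by (rule has_derivative_mult)
    show "Ck_on k S (\<lambda>x. f x * frechet_derivative h (at x) v + frechet_derivative f (at x) v * h x)"
      for v
      using Suc.prems Suc.prems[THEN Ck_on_SucD] by (intro Ck_on_add[OF assms(1)] Suc.IH) auto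
  qed
qed

lemma Ck_on_const: "Ck_on k S (\<lambda>x. c)"
proof (induction k arbitrary: c)
  case (Suc k)
  then show ?case by (simp add: frechet_derivative_const)
qed auto

lemma Ck_on_inverse:
  fixes f :: "'b::real_normed_vector \<Rightarrow> 'c::real_normed_div_algebra"
  assumes "open S" "Ck_on k S f" "\<And>x. x \<in> S \<Longrightarrow> f x \<noteq> 0"
  shows "Ck_on k S (\<lambda>x. inverse (f x))"
  using assms(2)
proof (induction k)
  case 0
  then show ?case using assms(3) by (auto intro: continuous_on_inverse)
next
  case (Suc k)
  show ?case
  proof (rule Ck_on_SucI[OF assms(1)])
    show "((\<lambda>x. inverse (f x)) has_derivative
        (\<lambda>v. (- 1) * (inverse (f x) * frechet_derivative f (at x) v * inverse (f x)))) (at x)"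
      if "x \<in> S" for x
      using Deriv.has_derivative_inverse[OF assms(3)[OF that] Suc.prems[THEN Ck_on_has_derivative, OF that]]
      by simp
    show "Ck_on k S
        (\<lambda>x. (- 1) * (inverse (f x) * frechet_derivative f (at x) v * inverse (f x)))" for v
      using Suc.IH Suc.prems Ck_on_SucD[OF Suc.prems]
      by (intro Ck_on_mult[OF assms(1)] Ck_on_const) auto
  qed
qed


section \<open>Smooth functions on a manifold\<close>

lemma chart_inj:
  assumes "smooth_manifold A" "(V, \<phi>) \<in> A"
  shows "inj_on \<phi> V"
proof -
  have "homeomorphism V (\<phi> ` V) \<phi> (inv_into V \<phi>)"
    using assms by (auto simp: smooth_manifold_def is_chart_def)
  then show ?thesis
    by (auto simp: homeomorphism_def intro: inj_on_inverseI)
qed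

lemma chart_open_image:
  assumes "smooth_manifold A" "(V, \<phi>) \<in> A" "open U"
  shows "open (\<phi> ` (U \<inter> V))"
proof -
  have V: "open V" "open (\<phi> ` V)" and hom: "homeomorphism V (\<phi> ` V) \<phi> (inv_into V \<phi>)"
    using assms by (auto simp: smooth_manifold_def is_chart_def)
  have "openin (top_of_set V) (U \<inter> V)"
    using assms(3) V by (auto simp: openin_open)
  from homeomorphism_imp_open_map[OF hom this] V(2) show ?thesis
    using openin_open_eq by blast
qed

lemma smooth_fun_on_subset: "smooth_fun_on A T f \<Longrightarrow> S \<subseteq> T \<Longrightarrow> smooth_fun_on A S f"
  unfolding smooth_fun_on_def smooth_on_def
  by (fastforce elim: Ck_on_subset)

lemma smooth_fun_on_const: "smooth_fun_on A U (\<lambda>p. c)"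
  by (auto simp: smooth_fun_on_def smooth_on_def o_def Ck_on_const)

lemma smooth_fun_on_add:
  assumes "smooth_manifold A" "open U" "smooth_fun_on A U f" "smooth_fun_on A U h"
  shows "smooth_fun_on A U (\<lambda>p. f p + h p)"
  using assms chart_open_image[OF assms(1) _ assms(2)]
  by (auto simp: smooth_fun_on_def smooth_on_def o_def intro!: Ck_on_add)

lemma smooth_fun_on_mult:
  assumes "smooth_manifold A" "open U" "smooth_fun_on A U f" "smooth_fun_on A U h"
  shows "smooth_fun_on A U (\<lambda>p. f p * h p)"
  using assms chart_open_image[OF assms(1) _ assms(2)]
  by (auto simp: smooth_fun_on_def smooth_on_def o_def intro!: Ck_on_mult)

lemma smooth_fun_on_inverse:
  assumes "smooth_manifold A" "open U" "smooth_fun_on A U f" "\<And>p. p \<in> U \<Longrightarrow> f p \<noteq> 0"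
  shows "smooth_fun_on A U (\<lambda>p. inverse (f p))"
  unfolding smooth_fun_on_def smooth_on_def o_def
proof (safe, rule Ck_on_inverse)
  fix V \<phi> k
  assume c: "(V, \<phi>) \<in> A"
  show "open (\<phi> ` (U \<inter> V))"
    using chart_open_image[OF assms(1) c assms(2)] .
  show "Ck_on k (\<phi> ` (U \<inter> V)) (\<lambda>x. f (inv_into V \<phi> x))"
    using assms(3) c by (auto simp: smooth_fun_on_def smooth_on_def o_def)
  show "f (inv_into V \<phi> x) \<noteq> 0" if "x \<in> \<phi> ` (U \<inter> V)" for x
    using that assms(4) chart_inj[OF assms(1) c] by auto
qed

lemma smooth_fun_on_cong:
  assumes "smooth_manifold A" "open U" "\<And>p. p \<in> U \<Longrightarrow> f p = h p" "smooth_fun_on A U f"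
  shows "smooth_fun_on A U h"
  unfolding smooth_fun_on_def smooth_on_def
proof safe
  fix V \<phi> k
  assume c: "(V, \<phi>) \<in> A"
  show "Ck_on k (\<phi> ` (U \<inter> V)) (h \<circ> inv_into V \<phi>)"
  proof (rule Ck_on_cong[OF chart_open_image[OF assms(1) c assms(2)]])
    show "Ck_on k (\<phi> ` (U \<inter> V)) (f \<circ> inv_into V \<phi>)"
      using assms(4) c by (auto simp: smooth_fun_on_def smooth_on_def)
    show "(f \<circ> inv_into V \<phi>) x = (h \<circ> inv_into V \<phi>) x" if "x \<in> \<phi> ` (U \<inter> V)" for x
      using that assms(3) chart_inj[OF assms(1) c] by auto
  qed
qed

lemma smooth_fun_on_local:
  assumes "smooth_manifold A" "\<And>p. p \<in> S \<Longrightarrow> \<exists>U. open U \<and> p \<in> U \<and> smooth_fun_on A U f"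
  shows "smooth_fun_on A S f"
  unfolding smooth_fun_on_def smooth_on_def
proof (safe, rule Ck_on_local)
  fix V \<phi> k x
  assume c: "(V, \<phi>) \<in> A" and "x \<in> \<phi> ` (S \<inter> V)"
  then obtain p where p: "p \<in> S" "p \<in> V" "x = \<phi> p" by blast
  from assms(2)[OF p(1)] obtain U where U: "open U" "p \<in> U" "smooth_fun_on A U f" by blast
  show "\<exists>T. open T \<and> x \<in> T \<and> Ck_on k T (f \<circ> inv_into V \<phi>)"
    using chart_open_image[OF assms(1) c U(1)] U p c
    by (intro exI[of _ "\<phi> ` (U \<inter> V)"]) (auto simp: smooth_fun_on_def smooth_on_def)
qed

lemma smooth_functions_mult:
  "smooth_manifold A \<Longrightarrow> f \<in> smooth_functions A \<Longrightarrow> h \<in> smooth_functions A \<Longrightarrow>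
    f * h \<in> smooth_functions A"
  using smooth_fun_on_mult[of A UNIV f h] by (simp add: smooth_functions_def times_fun_def)


section \<open>Tangent vectors and vector fields\<close>

lemma subspace_tangent_space: "subspace (tangent_space A p)"
  unfolding subspace_def
  by (auto simp: tangent_space_def scaleR_fun_def algebra_simps)

lemma tangent_space_apply_0:
  assumes "v \<in> tangent_space A p"
  shows "v 0 = 0"
  \<comment> \<open>If \<open>0\<close> were not smooth, the default value of \<open>v\<close> would still be \<open>0\<close>.\<close>
proof (cases "(0 :: 'a \<Rightarrow> real) \<in> smooth_functions A")
  case True
  then have "v (0 *\<^sub>R 0) = 0 * v 0"
    using assms unfolding tangent_space_def by blast
  then show ?thesis by simp
next
  case False
  then show ?thesis using assms unfolding tangent_space_def by blast
qed

lemma smooth_vfield_on_subset: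
  "smooth_vfield_on A T X \<Longrightarrow> S \<subseteq> T \<Longrightarrow> smooth_vfield_on A S X"
  unfolding smooth_vfield_on_def by (blast intro: smooth_fun_on_subset)

lemma smooth_vfield_on_add:
  assumes "smooth_manifold A" "open U" "smooth_vfield_on A U X" "smooth_vfield_on A U Y"
  shows "smooth_vfield_on A U (X + Y)"
  using assms
  by (auto simp: smooth_vfield_on_def intro!: smooth_fun_on_add
      subspace_add[OF subspace_tangent_space])

lemma smooth_vfield_on_scale:
  assumes "smooth_manifold A" "open U" "smooth_fun_on A U c" "smooth_vfield_on A U X"
  shows "smooth_vfield_on A U (vf_scale c X)"
proof -
  have "smooth_fun_on A U (\<lambda>p. c p * X p f)" if "f \<in> smooth_functions A" for f
    using assms that by (intro smooth_fun_on_mult) (auto simp: smooth_vfield_on_def)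
  moreover have "vf_scale c X p \<in> tangent_space A p" if "p \<in> U" for p
    using assms that by (auto simp: smooth_vfield_on_def vf_scale_def
        intro!: subspace_mul[OF subspace_tangent_space])
  ultimately show ?thesis
    by (simp add: smooth_vfield_on_def vf_scale_def scaleR_fun_def)
qed

lemma vector_fields_tangent: "X \<in> vector_fields A \<Longrightarrow> X p \<in> tangent_space A p"
  by (simp add: vector_fields_def smooth_vfield_on_def)

lemma vf_apply_smooth:
  "X \<in> vector_fields A \<Longrightarrow> f \<in> smooth_functions A \<Longrightarrow> vf_apply X f \<in> smooth_functions A"
  by (simp add: vector_fields_def smooth_vfield_on_def smooth_functions_def vf_apply_def)

lemma vf_apply_nonsmooth:
  "X \<in> vector_fields A \<Longrightarrow> f \<notin> smooth_functions A \<Longrightarrow> vf_apply X f = 0"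
  using vector_fields_tangent[of X A]
  by (auto simp: vf_apply_def tangent_space_def fun_eq_iff)

lemma vf_apply_add:
  "X \<in> vector_fields A \<Longrightarrow> f \<in> smooth_functions A \<Longrightarrow> h \<in> smooth_functions A \<Longrightarrow>
    vf_apply X (f + h) = vf_apply X f + vf_apply X h"
  using vector_fields_tangent[of X A]
  by (auto simp: vf_apply_def tangent_space_def fun_eq_iff)

lemma vf_apply_scaleR:
  "X \<in> vector_fields A \<Longrightarrow> f \<in> smooth_functions A \<Longrightarrow> vf_apply X (c *\<^sub>R f) = c *\<^sub>R vf_apply X f"
  using vector_fields_tangent[of X A]
  by (auto simp: vf_apply_def tangent_space_def fun_eq_iff scaleR_fun_def)

lemma vf_apply_mult:
  "X \<in> vector_fields A \<Longrightarrow> f \<in> smooth_functions A \<Longrightarrow> h \<in> smooth_functions A \<Longrightarrow>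
    vf_apply X (f * h) = f * vf_apply X h + h * vf_apply X f"
  using vector_fields_tangent[of X A]
  by (auto simp: vf_apply_def tangent_space_def fun_eq_iff)

text \<open>The second-order terms of the commutator are symmetric in the two fields and cancel, which
  leaves the Leibniz rule.\<close>

lemma lie_bracket_in_tangent_space:
  assumes M: "smooth_manifold A" and X: "X \<in> vector_fields A" and Y: "Y \<in> vector_fields A"
  shows "lie_bracket X Y p \<in> tangent_space A p"
proof -
  have eq: "lie_bracket X Y p f = vf_apply X (vf_apply Y f) p - vf_apply Y (vf_apply X f) p" for f
    by (simp add: lie_bracket_def vf_apply_def)
  note rules = vf_apply_add[of _ A] vf_apply_scaleR[of _ A] vf_apply_mult[of _ A]
    vf_apply_smooth[of _ A] smooth_functions_mult[OF M]
  have "lie_bracket X Y p f = 0" if "f \<notin> smooth_functions A" for f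
    using vf_apply_nonsmooth[OF X that] vf_apply_nonsmooth[OF Y that]
      tangent_space_apply_0[OF vector_fields_tangent[OF X]]
      tangent_space_apply_0[OF vector_fields_tangent[OF Y]]
    by (simp add: eq) (simp add: vf_apply_def)
  moreover have "lie_bracket X Y p (f + h) = lie_bracket X Y p f + lie_bracket X Y p h"
    if "f \<in> smooth_functions A" "h \<in> smooth_functions A" for f h
    using X Y that by (simp add: eq rules)
  moreover have "lie_bracket X Y p (c *\<^sub>R f) = c * lie_bracket X Y p f"
    if "f \<in> smooth_functions A" for f c
    using X Y that by (simp add: eq rules) (simp add: scaleR_fun_def algebra_simps)
  moreover have "lie_bracket X Y p (f * h) = f p * lie_bracket X Y p h + h p * lie_bracket X Y p f"
    if "f \<in> smooth_functions A" "h \<in> smooth_functions A" for f h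
    using X Y that by (simp add: eq rules) (simp add: algebra_simps)
  ultimately show ?thesis
    unfolding tangent_space_def by blast
qed


section \<open>Inner products on a subspace\<close>

locale subspace_inner_product =
  fixes V :: "'v::real_vector set" and b :: "'v \<Rightarrow> 'v \<Rightarrow> real"
  assumes subspace: "subspace V" and inner: "inner_product_on V b"
begin

lemma commute: "v \<in> V \<Longrightarrow> w \<in> V \<Longrightarrow> b v w = b w v"
  using inner by (simp add: inner_product_on_def)

lemma add_left: "u \<in> V \<Longrightarrow> v \<in> V \<Longrightarrow> w \<in> V \<Longrightarrow> b (u + v) w = b u w + b v w"
  using inner by (simp add: inner_product_on_def)

lemma scale_left: "v \<in> V \<Longrightarrow> w \<in> V \<Longrightarrow> b (c *\<^sub>R v) w = c * b v w"
  using inner by (simp add: inner_product_on_def)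

lemma pos: "v \<in> V \<Longrightarrow> v \<noteq> 0 \<Longrightarrow> b v v > 0"
  using inner by (simp add: inner_product_on_def)

lemma diff_left: "u \<in> V \<Longrightarrow> v \<in> V \<Longrightarrow> w \<in> V \<Longrightarrow> b (u - v) w = b u w - b v w"
  using add_left[of "u - v" v w] subspace_diff[OF subspace] by simp

lemma add_right: "u \<in> V \<Longrightarrow> v \<in> V \<Longrightarrow> w \<in> V \<Longrightarrow> b w (u + v) = b w u + b w v"
  using add_left[of u v w] commute subspace_add[OF subspace] by simp

lemma scale_right: "v \<in> V \<Longrightarrow> w \<in> V \<Longrightarrow> b w (c *\<^sub>R v) = c * b w v"
  using scale_left[of v w c] commute subspace_mul[OF subspace] by simp

lemma zero_right: "w \<in> V \<Longrightarrow> b w 0 = 0"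
  using scale_right[of w w 0] by simp

lemma orthogonal_span:
  assumes "S \<subseteq> V" "w \<in> V" "\<And>s. s \<in> S \<Longrightarrow> b w s = 0" "y \<in> span S"
  shows "b w y = 0"
proof -
  have "subspace {y \<in> V. b w y = 0}"
    using subspace assms(2) zero_right
    by (auto simp: subspace_def add_right scale_right)
  then have "span S \<subseteq> {y \<in> V. b w y = 0}"
    using assms(1,3) by (intro span_minimal) auto
  then show ?thesis using assms(4) by blast
qed

end

lemma riemannian_inner:
  "riemannian_manifold A g \<Longrightarrow> subspace_inner_product (tangent_space A p) (g p)"
  by (simp add: riemannian_manifold_def riemannian_metric_def subspace_inner_product_def
      subspace_tangent_space)


section \<open>The second fundamental form vanishes\<close>

lemma second_fundamental_form_eq_0:
  assumes R: "riemannian_manifold A g" and inv: "involutive A E" and LC: "levi_civita_wrt A g E D"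
    and X: "X \<in> sections A E" and Y: "Y \<in> sections A E" and \<xi>: "\<xi> \<in> sections A (orth A g E)"
  shows "g p (D X Y p) (\<xi> p) = 0" "g p (Y p) (D X \<xi> p) = 0"
proof -
  interpret subspace_inner_product "tangent_space A p" "g p"
    using R by (rule riemannian_inner)
  have M: "smooth_manifold A"
    using R by (simp add: riemannian_manifold_def)
  have vf: "X \<in> vector_fields A" "Y \<in> vector_fields A" "\<xi> \<in> vector_fields A"
    using X Y \<xi> by (simp_all add: sections_def)
  have Dvf: "D X' Y' \<in> vector_fields A" if "X' \<in> vector_fields A" "Y' \<in> vector_fields A" for X' Y'
    using LC that by (simp add: levi_civita_wrt_def affine_connection_def)
  note tan = vector_fields_tangent[OF vf(1), of p] vector_fields_tangent[OF vf(2), of p]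
    vector_fields_tangent[OF vf(3), of p]
  note Dtan = vector_fields_tangent[OF Dvf, of _ _ p]
  note Ltan = lie_bracket_in_tangent_space[OF M, of _ _ p]
  have compat: "vf_apply X' (metric_apply g Y' Z') p = g p (D X' Y' p) (Z' p) + g p (Y' p) (D X' Z' p)"
    if "X' \<in> vector_fields A" "Y' \<in> vector_fields A" "Z' \<in> vector_fields A" for X' Y' Z'
  proof -
    have "vf_apply X' (metric_apply g Y' Z') = metric_apply g (D X' Y') Z' + metric_apply g Y' (D X' Z')"
      using LC that unfolding levi_civita_wrt_def metric_compatible_def by blast
    then show ?thesis by (simp add: metric_apply_def)
  qed
  have orth0: "g q (\<xi> q) (Z q) = 0" if "Z \<in> sections A E" for Z q
    using \<xi> that by (auto simp: sections_def orth_def)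
  have skew: "g p (D Z Z' p) (\<xi> p) = - g p (Z' p) (D Z \<xi> p)"
    if "Z \<in> vector_fields A" "Z' \<in> sections A E" for Z Z'
  proof -
    interpret q: subspace_inner_product "tangent_space A q" "g q" for q
      using R by (rule riemannian_inner)
    have Z': "Z' \<in> vector_fields A" using that(2) by (simp add: sections_def)
    have "metric_apply g Z' \<xi> = 0"
      using orth0[OF that(2)] q.commute[OF vector_fields_tangent[OF Z'] vector_fields_tangent[OF vf(3)]]
      by (simp add: metric_apply_def fun_eq_iff)
    then have "vf_apply Z (metric_apply g Z' \<xi>) p = 0"
      using tangent_space_apply_0[OF vector_fields_tangent[OF that(1)]] by (simp add: vf_apply_def)
    with compat[OF that(1) Z' vf(3)] show ?thesis by simp
  qed
  have tors: "2 * (g p (D \<xi> Z p) (Z' p) - g p (D Z \<xi> p) (Z' p) - g p (lie_bracket \<xi> Z p) (Z' p))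
      = vf_apply \<xi> (metric_apply g Z Z') p
        - g p (lie_bracket \<xi> Z p) (Z' p) - g p (Z p) (lie_bracket \<xi> Z' p)"
    if "Z \<in> sections A E" "Z' \<in> sections A E" for Z Z'
  proof -
    have v: "Z \<in> vector_fields A" "Z' \<in> vector_fields A"
      using that by (simp_all add: sections_def)
    have "metric_apply g (torsion D \<xi> Z) Z' = (1/2) *\<^sub>R lie_derivative \<xi> g Z Z'"
      using LC that \<xi> unfolding levi_civita_wrt_def by blast
    then have "metric_apply g (torsion D \<xi> Z) Z' p = (1/2) * lie_derivative \<xi> g Z Z' p"
      by (simp add: scaleR_fun_def)
    moreover have "metric_apply g (torsion D \<xi> Z) Z' p
        = g p (D \<xi> Z p) (Z' p) - g p (D Z \<xi> p) (Z' p) - g p (lie_bracket \<xi> Z p) (Z' p)"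
      using v vf(3)
      by (simp add: metric_apply_def torsion_def diff_left Dtan Ltan
          vector_fields_tangent[of _ A] subspace_diff[OF subspace])
    ultimately show ?thesis
      by (simp add: lie_derivative_def metric_apply_def)
  qed
  have metr: "vf_apply \<xi> (metric_apply g X Y) p = g p (D \<xi> X p) (Y p) + g p (D \<xi> Y p) (X p)"
    "vf_apply \<xi> (metric_apply g Y X) p = g p (D \<xi> X p) (Y p) + g p (D \<xi> Y p) (X p)"
    using compat[OF vf(3,1,2)] compat[OF vf(3,2,1)] vf tan
    by (simp_all add: commute[OF _ Dtan])
  \<comment> \<open>In the sum of \<open>tors\<close> for \<open>(X, Y)\<close> and \<open>(Y, X)\<close>, the derivative of \<open>g(X, Y)\<close> along \<open>\<xi>\<close>
    and all brackets occur twice on either side and cancel.\<close>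
  have "g p (Y p) (D X \<xi> p) + g p (X p) (D Y \<xi> p) = 0"
    using tors[OF X Y] tors[OF Y X] metr vf tan
    by (simp add: commute[OF _ Dtan] commute[OF _ Ltan])
  with skew[OF vf(1) Y] skew[OF vf(2) X]
  have antisym: "g p (D X Y p) (\<xi> p) + g p (D Y X p) (\<xi> p) = 0"
    by simp
  have "torsion D X Y = 0"
    using LC X Y unfolding levi_civita_wrt_def by blast
  then have "D X Y p - D Y X p = lie_bracket X Y p"
    by (metis (no_types, lifting) eq_iff_diff_eq_0 minus_apply torsion_def)
  moreover have "lie_bracket X Y \<in> sections A E"
    using inv X Y by (auto simp: involutive_def)
  then have "g p (lie_bracket X Y p) (\<xi> p) = 0"
    using orth0[of "lie_bracket X Y" p] commute[OF Ltan[OF vf(1,2)] tan(3)] by simp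
  ultimately have "g p (D X Y p) (\<xi> p) = g p (D Y X p) (\<xi> p)"
    using diff_left[OF Dtan[OF vf(1,2)] Dtan[OF vf(2,1)] tan(3)] by simp
  with antisym show *: "g p (D X Y p) (\<xi> p) = 0"
    by simp
  with skew[OF vf(1) Y] show "g p (Y p) (D X \<xi> p) = 0"
    by simp
qed


section \<open>Smooth orthogonal components\<close>

text \<open>Spanning an \<open>r\<close>-dimensional space, the \<open>r\<close> vectors admit no redundant one, as deleting it
  would leave too small a spanning set.\<close>

lemma spanning_family_independent:
  fixes e :: "nat \<Rightarrow> 'v::real_vector"
  assumes "dim (span (e ` {..<r})) = r" "k < r"
  shows "e k \<notin> span (e ` {..<k})"
proof
  assume k: "e k \<in> span (e ` {..<k})"
  let ?S = "e ` ({..<r} - {k})"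
  have "e ` {..<k} \<subseteq> ?S" using assms(2) by auto
  then have "e k \<in> span ?S" using k span_mono by blast
  moreover have "e ` {..<r} = insert (e k) ?S" using assms(2) by auto
  ultimately have "span (e ` {..<r}) = span ?S" by (simp add: span_redundant)
  then have "r \<le> card ?S"
    using dim_le_card[of "span (e ` {..<r})" ?S] assms(1) by simp
  also have "\<dots> \<le> card ({..<r} - {k})" by (rule card_image_le) simp
  also have "\<dots> < r" using assms(2) by simp
  finally show False by simp
qed

text \<open>A Gram-Schmidt step: if \<open>W\<close> and \<open>N\<close> are the components of \<open>Z\<close> and of \<open>e k\<close> orthogonal to
  the first \<open>k\<close> frame fields, then \<open>W - (g(W, e k) / g(N, e k)) N\<close> is orthogonal to \<open>e k\<close> as well.
  Its smoothness is visible from the formula, since \<open>g(N, e k) = g(N, N)\<close> never vanishes.\<close>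

lemma local_orthogonal_component:
  fixes e :: "nat \<Rightarrow> 'a::{t2_space, second_countable_topology} vfield"
  assumes R: "riemannian_manifold A g" and U: "open U"
    and e: "\<And>i. i < k \<Longrightarrow> smooth_vfield_on A U (e i)"
    and indep: "\<And>i q. i < k \<Longrightarrow> q \<in> U \<Longrightarrow> e i q \<notin> span ((\<lambda>j. e j q) ` {..<i})"
    and Z: "smooth_vfield_on A U Z"
  shows "\<exists>W. smooth_vfield_on A U W \<and>
    (\<forall>q\<in>U. Z q - W q \<in> span ((\<lambda>i. e i q) ` {..<k}) \<and>
      (\<forall>y\<in>span ((\<lambda>i. e i q) ` {..<k}). g q (W q) y = 0))"
  using e indep Z
proof (induction k arbitrary: Z)
  case 0
  interpret subspace_inner_product "tangent_space A q" "g q" for q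
    using R by (rule riemannian_inner)
  show ?case
  proof (intro exI[of _ Z] conjI ballI)
    fix q y
    assume "q \<in> U" and y: "y \<in> span ((\<lambda>i. e i q) ` {..<0})"
    then show "g q (Z q) y = 0"
      using 0 by (intro orthogonal_span[OF _ _ _ y]) (auto simp: smooth_vfield_on_def)
  qed (use 0 in \<open>simp_all add: zero_fun_def\<close>)
next
  case (Suc k)
  interpret subspace_inner_product "tangent_space A q" "g q" for q
    using R by (rule riemannian_inner)
  have M: "smooth_manifold A"
    using R by (simp add: riemannian_manifold_def)
  let ?F = "\<lambda>q. (\<lambda>i. e i q) ` {..<k}"
  have ek: "smooth_vfield_on A U (e k)" using Suc.prems(1) by simp
  have component: "\<exists>W. smooth_vfield_on A U W \<and>
      (\<forall>q\<in>U. Z' q - W q \<in> span (?F q) \<and> (\<forall>y\<in>span (?F q). g q (W q) y = 0))"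
    if "smooth_vfield_on A U Z'" for Z'
  proof (rule Suc.IH[OF _ _ that])
    show "smooth_vfield_on A U (e i)" if "i < k" for i
      using Suc.prems(1) that by simp
    show "e i q \<notin> span ((\<lambda>j. e j q) ` {..<i})" if "i < k" "q \<in> U" for i q
      using Suc.prems(2)[of i q] that by simp
  qed
  let ?P = "\<lambda>Z' W. smooth_vfield_on A U W \<and>
      (\<forall>q\<in>U. Z' q - W q \<in> span (?F q) \<and> (\<forall>y\<in>span (?F q). g q (W q) y = 0))"
  obtain W where "?P Z W" using component[OF Suc.prems(3)] ..
  then have W: "smooth_vfield_on A U W"
      "\<And>q. q \<in> U \<Longrightarrow> Z q - W q \<in> span (?F q)"
      "\<And>q y. q \<in> U \<Longrightarrow> y \<in> span (?F q) \<Longrightarrow> g q (W q) y = 0"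
    by blast+
  obtain N where "?P (e k) N" using component[OF ek] ..
  then have N: "smooth_vfield_on A U N"
      "\<And>q. q \<in> U \<Longrightarrow> e k q - N q \<in> span (?F q)"
      "\<And>q y. q \<in> U \<Longrightarrow> y \<in> span (?F q) \<Longrightarrow> g q (N q) y = 0"
    by blast+
  have tan: "W q \<in> tangent_space A q" "N q \<in> tangent_space A q" "e k q \<in> tangent_space A q"
    if "q \<in> U" for q
    using W(1) N(1) ek that by (auto simp: smooth_vfield_on_def)
  have nz: "g q (N q) (e k q) \<noteq> 0" if q: "q \<in> U" for q
  proof -
    have "N q \<noteq> 0" using N(2)[OF q] Suc.prems(2)[of k q] q by auto
    moreover have "g q (N q) (e k q) = g q (N q) (N q) + g q (N q) (e k q - N q)"
      using add_right[of "N q" q "e k q - N q" "N q"] tan[OF q]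
      by (simp add: subspace_diff[OF subspace])
    ultimately show ?thesis
      using N(3)[OF q N(2)[OF q]] pos[OF tan(2)[OF q]] by simp
  qed
  define c where "c = (\<lambda>q. (-1) * (g q (W q) (e k q) * inverse (g q (N q) (e k q))))"
  define W' where "W' = W + vf_scale c N"
  have met: "smooth_fun_on A U (\<lambda>q. g q (X q) (Y q))"
    if "smooth_vfield_on A U X" "smooth_vfield_on A U Y" for X Y
  proof -
    have "smooth_fun_on A U (metric_apply g X Y)"
      using R U that unfolding riemannian_manifold_def riemannian_metric_def by blast
    then show ?thesis by (simp add: metric_apply_def)
  qed
  have "smooth_fun_on A U c"
    unfolding c_def using W(1) N(1) ek nz
    by (intro smooth_fun_on_mult[OF M U] smooth_fun_on_inverse[OF M U] smooth_fun_on_const met) auto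
  then have "smooth_vfield_on A U W'"
    unfolding W'_def using W(1) N(1) M U
    by (intro smooth_vfield_on_add smooth_vfield_on_scale)
  moreover have "Z q - W' q \<in> span ((\<lambda>i. e i q) ` {..<Suc k})" if q: "q \<in> U" for q
  proof -
    let ?T = "span ((\<lambda>i. e i q) ` {..<Suc k})"
    have sub: "span (?F q) \<subseteq> ?T" by (intro span_mono) auto
    have last: "e k q \<in> ?T" by (intro span_base) simp
    have "Z q - W' q = (Z q - W q) - c q *\<^sub>R e k q + c q *\<^sub>R (e k q - N q)"
      by (simp add: W'_def vf_scale_def scaleR_diff_right)
    also have "\<dots> \<in> ?T"
      by (rule span_add[OF span_diff[OF subsetD[OF sub W(2)[OF q]] span_scale[OF last]]
            span_scale[OF subsetD[OF sub N(2)[OF q]]]])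
    finally show ?thesis .
  qed
  moreover have "g q (W' q) y = 0"
    if q: "q \<in> U" and y: "y \<in> span ((\<lambda>i. e i q) ` {..<Suc k})" for q y
  proof (rule orthogonal_span[OF _ _ _ y])
    show et: "(\<lambda>i. e i q) ` {..<Suc k} \<subseteq> tangent_space A q"
      using Suc.prems(1) q by (auto simp: smooth_vfield_on_def)
    show "W' q \<in> tangent_space A q"
      using \<open>smooth_vfield_on A U W'\<close> q by (simp add: smooth_vfield_on_def)
    fix s assume s: "s \<in> (\<lambda>i. e i q) ` {..<Suc k}"
    have st: "s \<in> tangent_space A q" using s et by blast
    have exp: "g q (W' q) s = g q (W q) s + c q * g q (N q) s"
      using tan[OF q] st
      by (simp add: W'_def vf_scale_def add_left scale_left subspace_mul[OF subspace])
    show "g q (W' q) s = 0"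
    proof (cases "s \<in> ?F q")
      case True
      then show ?thesis using exp W(3)[OF q] N(3)[OF q] by (simp add: span_base)
    next
      case False
      with s have "s = e k q" by (auto simp: less_Suc_eq)
      then show ?thesis using exp nz[OF q] by (simp add: c_def)
    qed
  qed
  ultimately show ?case by blast
qed

text \<open>The orthogonal decomposition at a point is unique, so the local components agree on overlaps
  and glue to a global vector field.\<close>

lemma orthogonal_component:
  assumes R: "riemannian_manifold A g" and E: "distribution A r E" and Z: "Z \<in> vector_fields A"
  obtains W where "W \<in> sections A (orth A g E)" "\<And>p. Z p - W p \<in> E p"
proof -
  interpret subspace_inner_product "tangent_space A p" "g p" for p
    using R by (rule riemannian_inner)
  have M: "smooth_manifold A"
    using R by (simp add: riemannian_manifold_def)
  have Esub: "subspace (E p)" "E p \<subseteq> tangent_space A p" "dim (E p) = r" for p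
    using E by (auto simp: distribution_def)
  define comp where "comp = (\<lambda>p w. w \<in> orth A g E p \<and> Z p - w \<in> E p)"
  have unique: "w = w'" if "comp p w" "comp p w'" for p w w'
  proof -
    have t: "w \<in> tangent_space A p" "w' \<in> tangent_space A p"
      using that by (auto simp: comp_def orth_def)
    have "(Z p - w') - (Z p - w) \<in> E p"
      using that unfolding comp_def by (blast intro: subspace_diff[OF Esub(1)])
    then have d: "w - w' \<in> E p" by simp
    then have "g p w (w - w') = 0" "g p w' (w - w') = 0"
      using that by (auto simp: comp_def orth_def)
    then have "g p (w - w') (w - w') = 0"
      using diff_left t subspace_diff[OF subspace t] by simp
    then show ?thesis
      using pos[OF subspace_diff[OF subspace t]] by auto
  qed
  have loc: "\<exists>U W. open U \<and> p \<in> U \<and> smooth_vfield_on A U W \<and> (\<forall>q\<in>U. comp q (W q))" for p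
  proof -
    obtain U e where U: "open U" "p \<in> U" "\<And>i. i < r \<Longrightarrow> smooth_vfield_on A U (e i)"
        "\<And>q. q \<in> U \<Longrightarrow> E q = span ((\<lambda>i. e i q) ` {..<r})"
      using E unfolding distribution_def by metis
    have indep: "e i q \<notin> span ((\<lambda>j. e j q) ` {..<i})" if "i < r" "q \<in> U" for i q
      using spanning_family_independent[of "\<lambda>j. e j q" r i] U(4)[OF that(2)] Esub(3)[of q] that(1)
      by simp
    have ZU: "smooth_vfield_on A U Z"
      using Z by (auto simp: vector_fields_def intro: smooth_vfield_on_subset)
    have "\<exists>W. smooth_vfield_on A U W \<and>
        (\<forall>q\<in>U. Z q - W q \<in> span ((\<lambda>i. e i q) ` {..<r}) \<and>
          (\<forall>y\<in>span ((\<lambda>i. e i q) ` {..<r}). g q (W q) y = 0))"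
      by (rule local_orthogonal_component[OF R U(1) _ _ ZU]) (erule U(3), erule (1) indep)
    then obtain W where W: "smooth_vfield_on A U W \<and>
        (\<forall>q\<in>U. Z q - W q \<in> span ((\<lambda>i. e i q) ` {..<r}) \<and>
          (\<forall>y\<in>span ((\<lambda>i. e i q) ` {..<r}). g q (W q) y = 0))" ..
    have "comp q (W q)" if q: "q \<in> U" for q
      using W q unfolding comp_def orth_def U(4)[OF q] smooth_vfield_on_def by blast
    with U W show ?thesis by blast
  qed
  define W where "W = (\<lambda>p. THE w. comp p w)"
  have W_eq: "W p = w" if "comp p w" for p w
    unfolding W_def by (rule the_equality[where P = "comp p", OF that unique[OF _ that]])
  have comp: "comp p (W p)" for p
  proof -
    obtain w where "comp p w" using loc[of p] by blast
    with W_eq[OF this] show ?thesis by simp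
  qed
  have "smooth_fun_on A UNIV (\<lambda>p. W p f)" if f: "f \<in> smooth_functions A" for f
  proof (rule smooth_fun_on_local[OF M])
    fix p
    obtain U W' where U: "open U" "p \<in> U" "smooth_vfield_on A U W'" "\<forall>q\<in>U. comp q (W' q)"
      using loc by blast
    have "W' q f = W q f" if "q \<in> U" for q
      using W_eq[OF U(4)[rule_format, OF that]] by simp
    moreover have "smooth_fun_on A U (\<lambda>q. W' q f)"
      using U(3) f by (simp add: smooth_vfield_on_def)
    ultimately have "smooth_fun_on A U (\<lambda>q. W q f)"
      by (rule smooth_fun_on_cong[OF M U(1)])
    with U show "\<exists>U. open U \<and> p \<in> U \<and> smooth_fun_on A U (\<lambda>p. W p f)" by blast
  qed
  then have "W \<in> sections A (orth A g E)"
    using comp by (auto simp: sections_def vector_fields_def smooth_vfield_on_def comp_def orth_def)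
  with comp that show ?thesis by (auto simp: comp_def)
qed


section \<open>Total geodesy\<close>

theorem theorem1p3:
  fixes A :: "('a::{t2_space, second_countable_topology}, 'n::finite) chart set"
    and g :: "'a metric"
    and E :: "'a \<Rightarrow> 'a tvec set"
    and r :: nat
    and D :: "'a connection"
  assumes "riemannian_manifold A g"
    and "distribution A r E"
    and "involutive A E"
    and "levi_civita_wrt A g E D"
  shows "(\<forall>X\<in>sections A E. \<forall>Y\<in>sections A E. \<forall>\<xi>\<in>sections A (orth A g E).
            metric_apply g (D X Y) \<xi> = 0 \<and> metric_apply g Y (D X \<xi>) = 0)
         \<and> totally_geodesic A D E"
proof (intro conjI ballI)
  fix X Y \<xi>
  assume "X \<in> sections A E" "Y \<in> sections A E" "\<xi> \<in> sections A (orth A g E)"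
  note h = second_fundamental_form_eq_0[OF assms(1,3,4) this]
  show "metric_apply g (D X Y) \<xi> = 0" "metric_apply g Y (D X \<xi>) = 0"
    using h by (simp_all add: metric_apply_def fun_eq_iff)
next
  show "totally_geodesic A D E"
    unfolding totally_geodesic_def
  proof (intro ballI)
    fix X Y
    assume X: "X \<in> sections A E" and Y: "Y \<in> sections A E"
    have Z: "D X Y \<in> vector_fields A"
      using assms(4) X Y by (simp add: levi_civita_wrt_def affine_connection_def sections_def)
    obtain W where W: "W \<in> sections A (orth A g E)" "\<And>p. D X Y p - W p \<in> E p"
      using orthogonal_component[OF assms(1,2) Z] by blast
    have "D X Y p \<in> E p" for p
    proof -
      interpret subspace_inner_product "tangent_space A p" "g p"
        using assms(1) by (rule riemannian_inner)
      have t: "D X Y p \<in> tangent_space A p" "W p \<in> tangent_space A p"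
        using Z W(1) by (simp_all add: sections_def vector_fields_tangent)
      have "g p (W p) (D X Y p - W p) = 0"
        using W by (auto simp: sections_def orth_def)
      then have "g p (D X Y p - W p) (W p) = 0"
        using commute t subspace_diff[OF subspace t] by simp
      then have "g p (W p) (W p) = 0"
        using second_fundamental_form_eq_0(1)[OF assms(1,3,4) X Y W(1), of p] diff_left t by simp
      then have "W p = 0" using pos t by force
      then show ?thesis using W(2)[of p] by simp
    qed
    then show "D X Y \<in> sections A E" using Z by (simp add: sections_def)
  qed
qed

end
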